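(* If $S$ is an anti-involutive semiring then $S$ is exact.
   Context: A semiring is a set $S$ with a commutative associative addition and an associative (not necessarily commutative) multiplication distributing over addition from both sides, such that for every non-empty finite subset $L\subseteq S$ there are local identities $0_L,1_L\in S$ with $a+0_Lb=1_La=a$ and $a+b0_L=a1_L=a$ for all $a,b\in L$. (No global zero or identity is required.) A semiring $S$ is idempotent if $a+a=a$ for all $a\in S$; it is then partially ordered by $x\leq y\Leftrightarrow x+y=y$. An anti-involutive semiring is an idempotent semiring $S$ equipped with an involutive anti-isomorphism $\overline{\phantom{x}}\colon S\to S$, that is, a function with $\overline{\overline{x}}=x$ for all $x\in S$ and such that for all $a,x,x'\in S$: $ax\leq x'$ implies $\overline{x'}\,a\leq\overline{x}$, and $xa\leq x'$ implies $a\,\overline{x'}\leq\overline{x}$. $S^{m\times n}$ is the set of $m\times n$ matrices over $S$, with the usual matrix addition and multiplication. For $A\in S^{m\times n}$, $\operatorname{Row}(A)=\{uA: u\in S^{1\times m}\}\subseteq S^{1\times n}$ and $\operatorname{Col}(A)=\{Av: v\in S^{n\times 1}\}\subseteq S^{m\times 1}$. A semiring $S$ is exact if for all positive integers $m,n$ and all $A\in S^{m\times n}$: (E1) if $x\in S^{1\times n}\setminus\operatorname{Row}(A)$ then there are $v,v'\in S^{n\times 1}$ with $Av=Av'$ but $xv\neq xv'$; and (E2) if $y\in S^{m\times 1}\setminus\operatorname{Col}(A)$ then there are $u,u'\in S^{1\times m}$ with $uA=u'A$ but $uy\neq u'y$. *)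

theory Defs
  imports "Jordan_Normal_Form.Matrix"
begin

text \<open>The library class \<open>semiring\<close> assumes neither a zero nor a one. The same pair
  \<open>z\<close>, \<open>e\<close> (the local zero and the local identity of \<open>L\<close>) serves on both sides.\<close>

class local_semiring = semiring +
  assumes local_identities:
    "finite L \<Longrightarrow> L \<noteq> {} \<Longrightarrow>
      \<exists>z e. \<forall>a\<in>L. \<forall>b\<in>L. a + z * b = a \<and> e * a = a \<and> a + b * z = a \<and> a * e = a"

class idempotent_semiring = local_semiring +
  assumes add_self: "a + a = a"
begin

definition natural_le :: "'a \<Rightarrow> 'a \<Rightarrow> bool" (infix "\<preceq>" 50) where
  "x \<preceq> y \<longleftrightarrow> x + y = y"

end

class anti_involutive_semiring = idempotent_semiring +
  fixes bar :: "'a \<Rightarrow> 'a"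
  assumes bar_bar: "bar (bar x) = x"
    and bar_left: "a * x \<preceq> x' \<Longrightarrow> bar x' * a \<preceq> bar x"
    and bar_right: "x * a \<preceq> x' \<Longrightarrow> a * bar x' \<preceq> bar x"

text \<open>\<open>sum_upto f k\<close> is \<open>f 0 + \<dots> + f k\<close>, with both ends included. The library's \<open>sum\<close>, and
  hence the library's matrix product, needs a global zero, which is not available here.\<close>

primrec sum_upto :: "(nat \<Rightarrow> 'a::semiring) \<Rightarrow> nat \<Rightarrow> 'a" where
  "sum_upto f 0 = f 0"
| "sum_upto f (Suc k) = sum_upto f k + f (Suc k)"

text \<open>The usual product; it is meaningful only if \<open>dim_col A = dim_row B\<close> is positive.\<close>

definition mat_prod :: "'a::semiring mat \<Rightarrow> 'a mat \<Rightarrow> 'a mat" (infixl "\<odot>" 70) where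
  "A \<odot> B = mat (dim_row A) (dim_col B)
     (\<lambda>(i, j). sum_upto (\<lambda>k. A $$ (i, k) * B $$ (k, j)) (dim_col A - 1))"

definition Row :: "'a::semiring mat \<Rightarrow> 'a mat set" where
  "Row A = {u \<odot> A | u. u \<in> carrier_mat 1 (dim_row A)}"

definition Col :: "'a::semiring mat \<Rightarrow> 'a mat set" where
  "Col A = {A \<odot> v | v. v \<in> carrier_mat (dim_col A) 1}"

definition exact :: "'a::local_semiring itself \<Rightarrow> bool" where
  "exact _ \<longleftrightarrow>
    (\<forall>m n. \<forall>A \<in> (carrier_mat m n :: 'a mat set). m > 0 \<longrightarrow> n > 0 \<longrightarrow>
      (\<forall>x \<in> carrier_mat 1 n - Row A.
        \<exists>v \<in> carrier_mat n 1. \<exists>v' \<in> carrier_mat n 1. A \<odot> v = A \<odot> v' \<and> x \<odot> v \<noteq> x \<odot> v') \<and>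
      (\<forall>y \<in> carrier_mat m 1 - Col A.
        \<exists>u \<in> carrier_mat 1 m. \<exists>u' \<in> carrier_mat 1 m. u \<odot> A = u' \<odot> A \<and> u \<odot> y \<noteq> u' \<odot> y))"

end

theory Submission
  imports Defs
begin

text \<open>Write \<open>\<preceq>\<close> for the natural order and \<open>bar\<close> for the anti-involution. The two axioms on
  \<open>bar\<close> amount to residuation: \<open>a * x \<preceq> y\<close> iff \<open>bar y * a \<preceq> bar x\<close>. Taking \<open>a = x\<close> and replacing
  \<open>x\<close>, \<open>y\<close> by \<open>bar y\<close>, \<open>bar e\<close>, it follows that \<open>x * bar y \<preceq> bar e\<close> iff \<open>x \<preceq> y\<close>
  whenever \<open>e * x = x\<close>.

  Let \<open>x\<close> be a row outside the row space of \<open>A\<close>. Put \<open>v = bar x\<close> (transposed) and \<open>u = bar (A v)\<close>,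
  entrywise. By residuation \<open>u A \<preceq> x\<close>; in fact \<open>u\<close> is the greatest row with this property. Now
  put \<open>v' = bar (u A)\<close>. Residuation turns \<open>A v' \<preceq> A v'\<close> into \<open>bar (A v') A \<preceq> u A \<preceq> x\<close>, and this
  back into \<open>A v \<preceq> A v'\<close>; conversely \<open>u A \<preceq> bar v'\<close> becomes \<open>A v' \<preceq> bar u = A v\<close>. So
  \<open>A v = A v'\<close>. Let \<open>e\<close> be a local identity for the entries of \<open>x\<close>. Then \<open>x v \<preceq> bar e\<close>. If
  \<open>x v' = x v\<close>, then every \<open>x\<^sub>j * bar (u A)\<^sub>j\<close> lies below \<open>bar e\<close>, so that \<open>x \<preceq> u A\<close> and therefore
  \<open>x = u A\<close>, contrary to the choice of \<open>x\<close>.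

  Residuation and local identities are all that the argument uses of the multiplication, and both
  survive reversing the order of the factors. So \<open>residuated_separation\<close> takes the multiplication
  as a parameter, and yields the claims on rows and on columns as two instances.\<close>

section \<open>The natural order\<close>

lemma natural_le_refl: "(x::'a::idempotent_semiring) \<preceq> x"
  by (simp add: natural_le_def add_self)

lemma natural_le_antisym: "(x::'a::idempotent_semiring) \<preceq> y \<Longrightarrow> y \<preceq> x \<Longrightarrow> x = y"
  by (simp add: natural_le_def add.commute)

lemma natural_le_trans: "(x::'a::idempotent_semiring) \<preceq> y \<Longrightarrow> y \<preceq> z \<Longrightarrow> x \<preceq> z"
  unfolding natural_le_def by (metis add.assoc)

lemma add_natural_le_iff: "(x::'a::idempotent_semiring) + y \<preceq> z \<longleftrightarrow> x \<preceq> z \<and> y \<preceq> z"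
  unfolding natural_le_def by (metis add.assoc add.commute add_self)

lemma sum_upto_natural_le_iff:
  fixes f :: "nat \<Rightarrow> 'a::idempotent_semiring"
  shows "sum_upto f n \<preceq> z \<longleftrightarrow> (\<forall>k\<le>n. f k \<preceq> z)"
  by (induction n) (auto simp: add_natural_le_iff le_Suc_eq)

lemma natural_le_sum_upto:
  fixes f :: "nat \<Rightarrow> 'a::idempotent_semiring"
  shows "k \<le> n \<Longrightarrow> f k \<preceq> sum_upto f n"
  using sum_upto_natural_le_iff natural_le_refl by blast

lemma sum_upto_cong: "(\<And>k. k \<le> n \<Longrightarrow> f k = g k) \<Longrightarrow> sum_upto f n = sum_upto g n"
  by (induction n) auto

section \<open>Residuation\<close>

lemma mult_natural_le_iff_left:
  fixes a x y :: "'a::anti_involutive_semiring"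
  shows "a * x \<preceq> y \<longleftrightarrow> bar y * a \<preceq> bar x"
  using bar_left bar_right bar_bar by metis

lemma mult_natural_le_iff_right:
  fixes a x y :: "'a::anti_involutive_semiring"
  shows "x * a \<preceq> y \<longleftrightarrow> a * bar y \<preceq> bar x"
  using bar_left bar_right bar_bar by metis

lemma finite_identity:
  fixes L :: "'a::local_semiring set"
  assumes "finite L"
  shows finite_left_identity: "\<exists>e. \<forall>a\<in>L. e * a = a"
    and finite_right_identity: "\<exists>e. \<forall>a\<in>L. a * e = a"
  using local_identities[OF assms] by (cases "L = {}"; blast)+

section \<open>Separation\<close>

text \<open>The separation of a row \<open>x\<close> from the rows \<open>u A\<close>, for any residuated multiplication.
  Matrices are functions here, with row indices in \<open>{..m}\<close> and column indices in \<open>{..n}\<close>; both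
  bounds are attained, as in \<open>sum_upto\<close>.\<close>

lemma residuated_separation:
  fixes mul :: "'a::anti_involutive_semiring \<Rightarrow> 'a \<Rightarrow> 'a" and A :: "nat \<Rightarrow> nat \<Rightarrow> 'a"
  assumes residuated: "\<And>a x y. mul a x \<preceq> y \<longleftrightarrow> mul (bar y) a \<preceq> bar x"
    and identity: "\<And>L. finite L \<Longrightarrow> \<exists>e. \<forall>a\<in>L. mul e a = a"
    and not_in_span: "\<And>u. \<exists>j\<le>n. sum_upto (\<lambda>i. mul (u i) (A i j)) m \<noteq> x j"
  shows "\<exists>v v'.
    (\<forall>i\<le>m. sum_upto (\<lambda>j. mul (A i j) (v j)) n = sum_upto (\<lambda>j. mul (A i j) (v' j)) n) \<and>
    sum_upto (\<lambda>j. mul (x j) (v j)) n \<noteq> sum_upto (\<lambda>j. mul (x j) (v' j)) n"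
proof -
  define v where "v j = bar (x j)" for j
  define u where "u i = bar (sum_upto (\<lambda>j. mul (A i j) (v j)) n)" for i
  define w where "w j = sum_upto (\<lambda>i. mul (u i) (A i j)) m" for j
  define v' where "v' j = bar (w j)" for j
  \<comment> \<open>Here \<open>w\<close> is \<open>u A\<close>.\<close>
  have w_le: "w j \<preceq> x j" if "j \<le> n" for j
  proof -
    have "mul (u i) (A i j) \<preceq> x j" for i
      using natural_le_sum_upto[OF that, of "\<lambda>j. mul (A i j) (v j)"]
        residuated[of "A i j" "v j" "bar (u i)"]
      by (simp add: u_def v_def bar_bar)
    then show ?thesis by (simp add: w_def sum_upto_natural_le_iff)
  qed
  have "sum_upto (\<lambda>j. mul (A i j) (v j)) n = sum_upto (\<lambda>j. mul (A i j) (v' j)) n"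
    if i: "i \<le> m" for i
  proof (rule natural_le_antisym)
    let ?s = "sum_upto (\<lambda>j. mul (A i j) (v' j)) n"
    have "mul (A i j) (v j) \<preceq> ?s" if j: "j \<le> n" for j
    proof -
      have "mul (A i j) (v' j) \<preceq> ?s"
        using natural_le_sum_upto[OF j, of "\<lambda>j. mul (A i j) (v' j)"] .
      then have "mul (bar ?s) (A i j) \<preceq> w j"
        using residuated[of "A i j" "v' j" ?s] by (simp add: v'_def bar_bar)
      then have "mul (bar ?s) (A i j) \<preceq> x j"
        using w_le[OF j] natural_le_trans by blast
      then show ?thesis
        using residuated[of "A i j" "v j" ?s] by (simp add: v_def bar_bar)
    qed
    then show "sum_upto (\<lambda>j. mul (A i j) (v j)) n \<preceq> ?s"
      by (simp add: sum_upto_natural_le_iff)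
    have "mul (A i j) (v' j) \<preceq> bar (u i)" for j
      using natural_le_sum_upto[OF i, of "\<lambda>i. mul (u i) (A i j)"]
        residuated[of "A i j" "v' j" "bar (u i)"]
      by (simp add: w_def v'_def bar_bar)
    then show "?s \<preceq> sum_upto (\<lambda>j. mul (A i j) (v j)) n"
      by (simp add: sum_upto_natural_le_iff u_def bar_bar)
  qed
  moreover have "sum_upto (\<lambda>j. mul (x j) (v j)) n \<noteq> sum_upto (\<lambda>j. mul (x j) (v' j)) n"
  proof
    assume eq: "sum_upto (\<lambda>j. mul (x j) (v j)) n = sum_upto (\<lambda>j. mul (x j) (v' j)) n"
    obtain e where e: "mul e (x j) = x j" if "j \<le> n" for j
      using identity[of "x ` {..n}"] by auto
    have below: "mul (x j) (bar y) \<preceq> bar e \<longleftrightarrow> x j \<preceq> y" if "j \<le> n" for j y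
      using residuated[of "x j" "bar y" "bar e"] e[OF that] by (simp add: bar_bar)
    have "sum_upto (\<lambda>j. mul (x j) (v j)) n \<preceq> bar e"
      by (simp add: sum_upto_natural_le_iff v_def below natural_le_refl)
    then have "\<forall>j\<le>n. x j \<preceq> w j"
      by (simp add: eq sum_upto_natural_le_iff v'_def below)
    then have "\<forall>j\<le>n. w j = x j"
      using w_le natural_le_antisym by blast
    then show False using not_in_span[of u] by (auto simp: w_def)
  qed
  ultimately show ?thesis by blast
qed

section \<open>Exactness\<close>

lemma exact_rows:
  fixes A :: "'a::anti_involutive_semiring mat"
  assumes A: "A \<in> carrier_mat m n" and m: "m > 0" and n: "n > 0"
    and x: "x \<in> carrier_mat 1 n - Row A"
  shows "\<exists>v \<in> carrier_mat n 1. \<exists>v' \<in> carrier_mat n 1. A \<odot> v = A \<odot> v' \<and> x \<odot> v \<noteq> x \<odot> v'"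
proof -
  have dims: "dim_row A = m" "dim_col A = n" "dim_row x = 1" "dim_col x = n"
    and x_notin: "x \<notin> Row A"
    using x A by auto
  have not_in_span:
    "\<exists>j\<le>n - 1. sum_upto (\<lambda>i. u i * A $$ (i, j)) (m - 1) \<noteq> x $$ (0, j)" for u
  proof (rule ccontr)
    let ?u = "mat 1 m (\<lambda>(_, i). u i)"
    assume neg: "\<not> ?thesis"
    have "?u \<odot> A = x"
    proof (rule eq_matI)
      fix i j assume ij: "i < dim_row x" "j < dim_col x"
      then have "sum_upto (\<lambda>k. ?u $$ (i, k) * A $$ (k, j)) (m - 1)
          = sum_upto (\<lambda>k. u k * A $$ (k, j)) (m - 1)"
        using m by (intro sum_upto_cong) (simp add: dims)
      then show "(?u \<odot> A) $$ (i, j) = x $$ (i, j)"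
        using neg ij by (simp add: mat_prod_def dims)
    qed (simp_all add: mat_prod_def dims)
    then have "x \<in> Row A"
      unfolding Row_def by (intro CollectI exI[of _ ?u]) (simp add: dims)
    then show False using x_notin by simp
  qed
  obtain v v' where
    v: "\<forall>i\<le>m - 1. sum_upto (\<lambda>j. A $$ (i, j) * v j) (n - 1)
          = sum_upto (\<lambda>j. A $$ (i, j) * v' j) (n - 1)" and
    xv: "sum_upto (\<lambda>j. x $$ (0, j) * v j) (n - 1) \<noteq> sum_upto (\<lambda>j. x $$ (0, j) * v' j) (n - 1)"
    using residuated_separation[where mul = "(*)" and A = "\<lambda>i j. A $$ (i, j)"
          and x = "\<lambda>j. x $$ (0, j)" and m = "m - 1" and n = "n - 1",
          OF mult_natural_le_iff_left finite_left_identity not_in_span]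
    by blast
  let ?col = "\<lambda>v. mat n 1 (\<lambda>(j, _). v j)"
  have prod_index: "(B \<odot> ?col w) $$ (i, 0) = sum_upto (\<lambda>j. B $$ (i, j) * w j) (n - 1)"
    if "i < dim_row B" "dim_col B = n" for B :: "'a mat" and i w
  proof -
    have "sum_upto (\<lambda>j. B $$ (i, j) * ?col w $$ (j, 0)) (n - 1)
        = sum_upto (\<lambda>j. B $$ (i, j) * w j) (n - 1)"
      using n by (intro sum_upto_cong) simp
    then show ?thesis using that by (simp add: mat_prod_def)
  qed
  have "A \<odot> ?col v = A \<odot> ?col v'"
  proof (rule eq_matI)
    fix i j assume "i < dim_row (A \<odot> ?col v')" "j < dim_col (A \<odot> ?col v')"
    then have "i < m" "j = 0" by (simp_all add: mat_prod_def dims)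
    then show "(A \<odot> ?col v) $$ (i, j) = (A \<odot> ?col v') $$ (i, j)"
      using v by (simp add: prod_index dims del: One_nat_def)
  qed (simp_all add: mat_prod_def)
  moreover have "(x \<odot> ?col v) $$ (0, 0) \<noteq> (x \<odot> ?col v') $$ (0, 0)"
    using xv by (simp add: prod_index dims del: One_nat_def)
  then have "x \<odot> ?col v \<noteq> x \<odot> ?col v'" by metis
  ultimately show ?thesis
    by (intro bexI[of _ "?col v"] bexI[of _ "?col v'"]) simp_all
qed

lemma exact_cols:
  fixes A :: "'a::anti_involutive_semiring mat"
  assumes A: "A \<in> carrier_mat m n" and m: "m > 0" and n: "n > 0"
    and y: "y \<in> carrier_mat m 1 - Col A"
  shows "\<exists>u \<in> carrier_mat 1 m. \<exists>u' \<in> carrier_mat 1 m. u \<odot> A = u' \<odot> A \<and> u \<odot> y \<noteq> u' \<odot> y"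
proof -
  have dims: "dim_row A = m" "dim_col A = n" "dim_row y = m" "dim_col y = 1"
    and y_notin: "y \<notin> Col A"
    using y A by auto
  have not_in_span:
    "\<exists>i\<le>m - 1. sum_upto (\<lambda>j. A $$ (i, j) * v j) (n - 1) \<noteq> y $$ (i, 0)" for v
  proof (rule ccontr)
    let ?v = "mat n 1 (\<lambda>(j, _). v j)"
    assume neg: "\<not> ?thesis"
    have "A \<odot> ?v = y"
    proof (rule eq_matI)
      fix i j assume ij: "i < dim_row y" "j < dim_col y"
      then have "sum_upto (\<lambda>k. A $$ (i, k) * ?v $$ (k, j)) (n - 1)
          = sum_upto (\<lambda>k. A $$ (i, k) * v k) (n - 1)"
        using n by (intro sum_upto_cong) (simp add: dims)
      then show "(A \<odot> ?v) $$ (i, j) = y $$ (i, j)"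
        using neg ij by (simp add: mat_prod_def dims)
    qed (simp_all add: mat_prod_def dims)
    then have "y \<in> Col A"
      unfolding Col_def by (intro CollectI exI[of _ ?v]) (simp add: dims)
    then show False using y_notin by simp
  qed
  \<comment> \<open>Under the reversed multiplication, \<open>y\<close> is a row and \<open>A\<close> becomes its transpose.\<close>
  obtain u u' where
    u: "\<forall>j\<le>n - 1. sum_upto (\<lambda>i. u i * A $$ (i, j)) (m - 1)
          = sum_upto (\<lambda>i. u' i * A $$ (i, j)) (m - 1)" and
    uy: "sum_upto (\<lambda>i. u i * y $$ (i, 0)) (m - 1) \<noteq> sum_upto (\<lambda>i. u' i * y $$ (i, 0)) (m - 1)"
    using residuated_separation[where mul = "\<lambda>a b. b * a" and A = "\<lambda>j i. A $$ (i, j)"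
          and x = "\<lambda>i. y $$ (i, 0)" and m = "n - 1" and n = "m - 1",
          OF mult_natural_le_iff_right finite_right_identity not_in_span]
    by blast
  let ?row = "\<lambda>u. mat 1 m (\<lambda>(_, i). u i)"
  have prod_index: "(?row w \<odot> B) $$ (0, j) = sum_upto (\<lambda>i. w i * B $$ (i, j)) (m - 1)"
    if "j < dim_col B" "dim_row B = m" for B :: "'a mat" and j w
  proof -
    have "sum_upto (\<lambda>i. ?row w $$ (0, i) * B $$ (i, j)) (m - 1)
        = sum_upto (\<lambda>i. w i * B $$ (i, j)) (m - 1)"
      using m by (intro sum_upto_cong) simp
    then show ?thesis using that by (simp add: mat_prod_def)
  qed
  have "?row u \<odot> A = ?row u' \<odot> A"
  proof (rule eq_matI)
    fix i j assume "i < dim_row (?row u' \<odot> A)" "j < dim_col (?row u' \<odot> A)"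
    then have "i = 0" "j < n" by (simp_all add: mat_prod_def dims)
    then show "(?row u \<odot> A) $$ (i, j) = (?row u' \<odot> A) $$ (i, j)"
      using u by (simp add: prod_index dims del: One_nat_def)
  qed (simp_all add: mat_prod_def)
  moreover have "(?row u \<odot> y) $$ (0, 0) \<noteq> (?row u' \<odot> y) $$ (0, 0)"
    using uy by (simp add: prod_index dims del: One_nat_def)
  then have "?row u \<odot> y \<noteq> ?row u' \<odot> y" by metis
  ultimately show ?thesis
    by (intro bexI[of _ "?row u"] bexI[of _ "?row u'"]) simp_all
qed

theorem theorem6p6: "exact TYPE('a::anti_involutive_semiring)"
  unfolding exact_def by (intro allI ballI impI conjI) (simp_all only: exact_rows exact_cols)

end
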